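(* Let $H(z)\in k\langle\langle z\rangle\rangle^{\times n}$ with $o(H(z))\ge 2$, and consider the Cauchy problem $$\frac{\partial W_t}{\partial t}=\left[W_t\frac{\partial}{\partial z}\right]W_t,\qquad W_{t=0}(z)=H(z) \qquad ( * )$$ for $W_t(z)\in k[[t]]\langle\langle z\rangle\rangle^{\times n}$. Write $W_t(z)=\sum_{m\ge1}W_{[m]}(z)t^{m-1}$ with $W_{[m]}(z)\in k\langle\langle z\rangle\rangle^{\times n}$. (a) When $\operatorname{char} k=0$, the power series solution in $k[[t]]\langle\langle z\rangle\rangle^{\times n}$ of $( * )$ is unique. (b) When $\operatorname{char} k=p>0$, there are infinitely many solutions $W_t(z)$ in $k[[t]]\langle\langle z\rangle\rangle^{\times n}$ of $( * )$. Actually, for any fixed $W_{[mp+1]}(z)\in k\langle\langle z\rangle\rangle^{\times n}$ $(m\ge 1)$, there exists one and only one solution of $( * )$ having these prescribed coefficients of $t^{mp}$ $(m\ge1)$.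
   Context: $k$ is a (commutative) unital integral domain; $n\ge 1$; $z=(z_1,\dots,z_n)$ are noncommutative free variables; $t$ is a formal parameter commuting with $z$. $k\langle\langle z\rangle\rangle$ and $k[[t]]\langle\langle z\rangle\rangle$ are the algebras of formal power series in the noncommuting variables $z_i$ over $k$ and $k[[t]]$. The order $o(U)$ of a vector $U$ is the minimum of the orders (lowest degree in $z$) of its components. For a vector $\vec u=(u_1,\dots,u_n)$ over $k[[t]]\langle\langle z\rangle\rangle$, $[\vec u\frac{\partial}{\partial z}]$ denotes the unique $k[[t]]$-derivation of $k[[t]]\langle\langle z\rangle\rangle$ sending $z_i$ to $u_i$ for all $i$; applied to a vector it acts componentwise. $\frac{\partial}{\partial t}$ acts coefficientwise, with $\frac{\partial z_i}{\partial t}=0$. *)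

theory Defs
  imports
    "HOL-Computational_Algebra.Formal_Power_Series"
    "HOL-Library.Extended_Nat"
begin

section \<open>Formal power series in noncommuting variables\<close>

text \<open>
  A power series over \<open>'a\<close> in noncommuting variables indexed by \<open>'n\<close> is the function giving
  the coefficient of each word (list) over \<open>'n\<close>.
\<close>

typedef ('n, 'a) ncps = "UNIV :: ('n list \<Rightarrow> 'a) set"
  morphisms ncps_nth Abs_ncps
  by simp

lemma ncps_nth_Abs [simp]: "ncps_nth (Abs_ncps f) = f"
  by (simp add: Abs_ncps_inverse)

lemma ncps_eqI: "(\<And>w. ncps_nth f w = ncps_nth g w) \<Longrightarrow> f = g"
  by (metis ncps_nth_inject ext)

lemma finite_splits2 [simp]: "finite {(u, v). u @ v = w}"
proof -
  have "(u, v) \<in> (\<lambda>i. (take i w, drop i w)) ` {..length w}" if "u @ v = w" for u v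
    using that by (intro image_eqI[where x = "length u"]) auto
  then have "{(u, v). u @ v = w} \<subseteq> (\<lambda>i. (take i w, drop i w)) ` {..length w}"
    by auto
  then show ?thesis
    by (rule finite_subset) simp
qed

lemma finite_splits2' [simp]: "finite {x. fst x @ snd x = w}"
  using finite_splits2[of w] by (simp add: case_prod_beta')

lemma finite_splits3 [simp]: "finite {(u, v, x). u @ v @ x = w}"
proof -
  have "{(u, v, x). u @ v @ x = w}
      \<subseteq> (\<Union>(u, y) \<in> {(u, y). u @ y = w}. (\<lambda>(v, x). (u, v, x)) ` {(v, x). v @ x = y})"
    by force
  then show ?thesis
    by (rule finite_subset) auto
qed

lemma splits2_Nil: "{(u, v). u @ v = []} = {([], [])}"
  by auto

lemma splits2_Cons:
  "{(u, v). u @ v = i # w} = insert ([], i # w) ((\<lambda>(u, v). (i # u, v)) ` {(u, v). u @ v = w})"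
  by (auto simp: append_eq_Cons_conv)

instantiation ncps :: (type, comm_ring_1) ring_1
begin

definition "0 = Abs_ncps (\<lambda>_. 0)"
definition "1 = Abs_ncps (\<lambda>w. if w = [] then 1 else 0)"
definition "f + g = Abs_ncps (\<lambda>w. ncps_nth f w + ncps_nth g w)"
definition "f - g = Abs_ncps (\<lambda>w. ncps_nth f w - ncps_nth g w)"
definition "- f = Abs_ncps (\<lambda>w. - ncps_nth f w)"
definition "f * g = Abs_ncps (\<lambda>w. \<Sum>(u, v) | u @ v = w. ncps_nth f u * ncps_nth g v)"

lemma ncps_nth_zero [simp]: "ncps_nth 0 w = 0"
  by (simp add: zero_ncps_def)

lemma ncps_nth_one: "ncps_nth 1 w = (if w = [] then 1 else 0)"
  by (simp add: one_ncps_def)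

lemma ncps_nth_add [simp]: "ncps_nth (f + g) w = ncps_nth f w + ncps_nth g w"
  by (simp add: plus_ncps_def)

lemma ncps_nth_diff [simp]: "ncps_nth (f - g) w = ncps_nth f w - ncps_nth g w"
  by (simp add: minus_ncps_def)

lemma ncps_nth_uminus [simp]: "ncps_nth (- f) w = - ncps_nth f w"
  by (simp add: uminus_ncps_def)

lemma ncps_nth_mult: "ncps_nth (f * g) w = (\<Sum>(u, v) | u @ v = w. ncps_nth f u * ncps_nth g v)"
  by (simp add: times_ncps_def)

lemma ncps_nth_mult_left:
  "ncps_nth (f * g * h) w
    = (\<Sum>(u, v, x) | u @ v @ x = w. ncps_nth f u * ncps_nth g v * ncps_nth h x)"
proof -
  have "ncps_nth (f * g * h) w =
      (\<Sum>q \<in> {(y, x). y @ x = w}. \<Sum>r \<in> {(u, v). u @ v = fst q}.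
        ncps_nth f (fst r) * ncps_nth g (snd r) * ncps_nth h (snd q))"
    by (simp add: ncps_nth_mult sum_distrib_right case_prod_beta')
  also have "\<dots> = (\<Sum>(q, r) \<in> (SIGMA q:{(y, x). y @ x = w}. {(u, v). u @ v = fst q}).
        ncps_nth f (fst r) * ncps_nth g (snd r) * ncps_nth h (snd q))"
    by (rule sum.Sigma) auto
  also have "\<dots> = (\<Sum>(u, v, x) | u @ v @ x = w. ncps_nth f u * ncps_nth g v * ncps_nth h x)"
    by (rule sum.reindex_bij_witness
        [where i = "\<lambda>(u, v, x). ((u @ v, x), (u, v))" and j = "\<lambda>((y, x), (u, v)). (u, v, x)"]) auto
  finally show ?thesis .
qed

lemma ncps_nth_mult_right:
  "ncps_nth (f * (g * h)) w
    = (\<Sum>(u, v, x) | u @ v @ x = w. ncps_nth f u * ncps_nth g v * ncps_nth h x)"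
proof -
  have "ncps_nth (f * (g * h)) w =
      (\<Sum>q \<in> {(u, y). u @ y = w}. \<Sum>r \<in> {(v, x). v @ x = snd q}.
        ncps_nth f (fst q) * ncps_nth g (fst r) * ncps_nth h (snd r))"
    by (simp add: ncps_nth_mult sum_distrib_left case_prod_beta' mult.assoc)
  also have "\<dots> = (\<Sum>(q, r) \<in> (SIGMA q:{(u, y). u @ y = w}. {(v, x). v @ x = snd q}).
        ncps_nth f (fst q) * ncps_nth g (fst r) * ncps_nth h (snd r))"
    by (rule sum.Sigma) auto
  also have "\<dots> = (\<Sum>(u, v, x) | u @ v @ x = w. ncps_nth f u * ncps_nth g v * ncps_nth h x)"
    by (rule sum.reindex_bij_witness
        [where i = "\<lambda>(u, v, x). ((u, v @ x), (v, x))" and j = "\<lambda>((u, y), (v, x)). (u, v, x)"]) auto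
  finally show ?thesis .
qed

lemma ncps_nth_mult_Nil [simp]: "ncps_nth (f * g) [] = ncps_nth f [] * ncps_nth g []"
  by (simp add: ncps_nth_mult splits2_Nil)

lemma ncps_nth_mult_Cons:
  "ncps_nth (f * g) (i # w) = ncps_nth f [] * ncps_nth g (i # w)
     + (\<Sum>(u, v) | u @ v = w. ncps_nth f (i # u) * ncps_nth g v)"
proof -
  have inj: "inj_on (\<lambda>(u, v). (i # u, v)) {(u, v). u @ v = w}"
    by (auto simp: inj_on_def)
  have "(\<Sum>(u, v) \<in> (\<lambda>(u, v). (i # u, v)) ` {(u, v). u @ v = w}. ncps_nth f u * ncps_nth g v)
      = (\<Sum>(u, v) | u @ v = w. ncps_nth f (i # u) * ncps_nth g v)"
    by (subst sum.reindex[OF inj]) (simp add: o_def case_prod_unfold)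
  moreover have "([], i # w) \<notin> (\<lambda>(u, v). (i # u, v)) ` {(u, v). u @ v = w}"
    by auto
  ultimately show ?thesis
    unfolding ncps_nth_mult splits2_Cons
    by (subst sum.insert) (simp_all only: finite_imageI finite_splits2 prod.case not_False_eq_True)
qed

instance
proof
  fix f g h :: "('a, 'b) ncps"
  show "f * g * h = f * (g * h)"
    by (rule ncps_eqI) (simp only: ncps_nth_mult_left ncps_nth_mult_right)
  show "1 * f = f"
  proof (rule ncps_eqI)
    fix w
    show "ncps_nth (1 * f) w = ncps_nth f w"
      by (cases w) (simp_all add: ncps_nth_mult_Cons ncps_nth_one)
  qed
  show "f * 1 = f"
  proof (rule ncps_eqI)
    fix w
    have "ncps_nth (f * 1) w = (\<Sum>(u, v) \<in> {(w, [])}. ncps_nth f u * ncps_nth 1 v)"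
      unfolding ncps_nth_mult
      by (rule sum.mono_neutral_cong_right) (auto simp: ncps_nth_one split: if_splits)
    then show "ncps_nth (f * 1) w = ncps_nth f w"
      by (simp add: ncps_nth_one)
  qed
  show "(f + g) * h = f * h + g * h" "f * (g + h) = f * g + f * h"
    by (rule ncps_eqI; simp add: ncps_nth_mult algebra_simps sum.distrib case_prod_beta')+
  show "(0 :: ('a, 'b) ncps) \<noteq> 1"
    by (metis ncps_nth_zero ncps_nth_one zero_neq_one)
qed (rule ncps_eqI; simp add: algebra_simps)+

end

lemma ncps_nth_sum [simp]: "ncps_nth (\<Sum>i\<in>A. F i) w = (\<Sum>i\<in>A. ncps_nth (F i) w)"
  by (induction A rule: infinite_finite_induct) auto

definition ncps_smult :: "'a::comm_ring_1 \<Rightarrow> ('n, 'a) ncps \<Rightarrow> ('n, 'a) ncps" where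
  "ncps_smult c f = Abs_ncps (\<lambda>w. c * ncps_nth f w)"

definition ncps_var :: "'n \<Rightarrow> ('n, 'a::comm_ring_1) ncps" where
  "ncps_var i = Abs_ncps (\<lambda>w. if w = [i] then 1 else 0)"

definition ncps_order :: "('n, 'a::comm_ring_1) ncps \<Rightarrow> enat" where
  "ncps_order f = (INF w \<in> {w. ncps_nth f w \<noteq> 0}. enat (length w))"

definition ncps_vec_order :: "('n \<Rightarrow> ('n, 'a::comm_ring_1) ncps) \<Rightarrow> enat" where
  "ncps_vec_order U = (INF i. ncps_order (U i))"


section \<open>Derivations\<close>

definition ncps_derivation :: "(('n, 'a::comm_ring_1) ncps \<Rightarrow> ('n, 'a) ncps) \<Rightarrow> bool" where
  "ncps_derivation D \<longleftrightarrow>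
     (\<forall>f g. D (f + g) = D f + D g) \<and>
     (\<forall>c f. D (ncps_smult c f) = ncps_smult c (D f)) \<and>
     (\<forall>f g. D (f * g) = D f * g + f * D g)"

text \<open>
  \<open>ncps_vfield u\<close> is \<open>[u \<partial>/\<partial>z]\<close>. That there is exactly one such derivation is lemma
  \<open>ncps_derivation_ex1\<close> below; no continuity requirement is needed since \<open>'n\<close> is finite.
\<close>

definition ncps_vfield ::
    "('n::finite \<Rightarrow> ('n, 'a::comm_ring_1) ncps) \<Rightarrow> ('n, 'a) ncps \<Rightarrow> ('n, 'a) ncps" where
  "ncps_vfield u = (THE D. ncps_derivation D \<and> (\<forall>i. D (ncps_var i) = u i))"

lemma ncps_nth_smult [simp]: "ncps_nth (ncps_smult c f) w = c * ncps_nth f w"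
  by (simp add: ncps_smult_def)

lemma ncps_nth_var: "ncps_nth (ncps_var i) w = (if w = [i] then 1 else 0)"
  by (simp add: ncps_var_def)

lemma ncps_nth_var_mult_Cons:
  "ncps_nth (ncps_var i * f) (j # w) = (if i = j then ncps_nth f w else 0)"
proof -
  have "(\<Sum>(u, v) | u @ v = w. ncps_nth (ncps_var i) (j # u) * ncps_nth f v)
      = (\<Sum>(u, v) \<in> {([], w)}. ncps_nth (ncps_var i) (j # u) * ncps_nth f v)"
    by (rule sum.mono_neutral_cong_right) (auto simp: ncps_nth_var split: if_splits)
  then show ?thesis
    by (auto simp: ncps_nth_mult_Cons ncps_nth_var)
qed

lemma ncps_decompose:
  fixes f :: "('n::finite, 'a::comm_ring_1) ncps"
  shows "f = ncps_smult (ncps_nth f []) 1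
             + (\<Sum>i\<in>UNIV. ncps_var i * Abs_ncps (\<lambda>w. ncps_nth f (i # w)))"
proof (rule ncps_eqI)
  fix w
  show "ncps_nth f w = ncps_nth (ncps_smult (ncps_nth f []) 1
             + (\<Sum>i\<in>UNIV. ncps_var i * Abs_ncps (\<lambda>w. ncps_nth f (i # w)))) w"
    by (cases w) (simp_all add: ncps_nth_one ncps_nth_var ncps_nth_var_mult_Cons)
qed

lemma ncps_derivation_eqI:
  fixes D D' :: "('n::finite, 'a::comm_ring_1) ncps \<Rightarrow> ('n, 'a) ncps"
  assumes D: "ncps_derivation D" and D': "ncps_derivation D'"
    and eq: "\<And>i. D (ncps_var i) = D' (ncps_var i)"
  shows "D = D'"
proof -
  have expand: "E f = (\<Sum>i\<in>UNIV. E (ncps_var i) * Abs_ncps (\<lambda>w. ncps_nth f (i # w))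
                          + ncps_var i * E (Abs_ncps (\<lambda>w. ncps_nth f (i # w))))"
    if E: "ncps_derivation E" for E :: "('n, 'a) ncps \<Rightarrow> ('n, 'a) ncps" and f
  proof -
    have add: "E (g + h) = E g + E h" and scale: "E (ncps_smult c g) = ncps_smult c (E g)"
      and mult: "E (g * h) = E g * h + g * E h" for g h c
      using E by (auto simp: ncps_derivation_def)
    have zero: "E 0 = 0"
      using add[of 0 0] by simp
    have one: "E 1 = 0"
      using mult[of 1 1] by simp
    have sum: "E (\<Sum>i\<in>A. F i) = (\<Sum>i\<in>A. E (F i))" for F and A :: "'n set"
      by (induction A rule: infinite_finite_induct) (simp_all add: zero add)
    have "ncps_smult c 0 = (0 :: ('n, 'a) ncps)" for c
      by (rule ncps_eqI) simp
    then show ?thesis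
      by (subst ncps_decompose[of f]) (simp add: add scale one sum mult)
  qed
  have "ncps_nth (D f) w = ncps_nth (D' f) w" for f w
  proof (induction w arbitrary: f)
    case Nil
    show ?case
      by (subst expand[OF D], subst expand[OF D']) (simp add: eq ncps_nth_var)
  next
    case (Cons j w)
    show ?case
      by (subst expand[OF D], subst expand[OF D'])
         (simp add: eq ncps_nth_var_mult_Cons Cons.IH cong: if_cong)
  qed
  then show ?thesis
    by (intro ext ncps_eqI)
qed

text \<open>
  Each occurrence of a letter \<open>i\<close> in a word is in turn replaced by \<open>u i\<close>.
\<close>

definition ncps_subst_der ::
    "('n::finite \<Rightarrow> ('n, 'a::comm_ring_1) ncps) \<Rightarrow> ('n, 'a) ncps \<Rightarrow> ('n, 'a) ncps" where
  "ncps_subst_der u f = Abs_ncps (\<lambda>w.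
     \<Sum>(a, b, c) | a @ b @ c = w. \<Sum>i\<in>UNIV. ncps_nth f (a @ i # c) * ncps_nth (u i) b)"

lemma sum_splits_insert:
  fixes F :: "'n list \<Rightarrow> 'n list \<Rightarrow> 'b::comm_monoid_add"
  shows "(\<Sum>(x, y) | x @ y = a @ i # c. F x y)
     = (\<Sum>(c1, c2) | c1 @ c2 = c. F (a @ i # c1) c2) + (\<Sum>(a1, a2) | a1 @ a2 = a. F a1 (a2 @ i # c))"
proof -
  have eq: "{(x, y). x @ y = a @ i # c}
      = (\<lambda>(c1, c2). (a @ i # c1, c2)) ` {(c1, c2). c1 @ c2 = c}
        \<union> (\<lambda>(a1, a2). (a1, a2 @ i # c)) ` {(a1, a2). a1 @ a2 = a}" (is "?L = ?A \<union> ?B")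
  proof (intro equalityI subsetI)
    fix q assume "q \<in> ?L"
    then obtain x y where q: "q = (x, y)" "x @ y = a @ i # c"
      by auto
    from q(2) consider us where "x = a @ us" "us @ y = i # c" | us where "x @ us = a" "y = us @ i # c"
      by (auto simp: append_eq_append_conv2)
    then show "q \<in> ?A \<union> ?B"
    proof cases
      case 1
      then show ?thesis
        by (cases us) (auto simp: q(1) image_iff)
    next
      case 2
      then show ?thesis
        by (auto simp: q(1) image_iff)
    qed
  qed auto
  have disj: "?A \<inter> ?B = {}"
    by (auto simp: append_eq_append_conv2)
  have inj: "inj_on (\<lambda>(c1, c2). (a @ i # c1, c2)) {(c1, c2). c1 @ c2 = c}"
    "inj_on (\<lambda>(a1, a2). (a1, a2 @ i # c)) {(a1, a2). a1 @ a2 = a}"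
    by (auto simp: inj_on_def)
  have "(\<Sum>(x, y) \<in> ?A. F x y) = (\<Sum>(c1, c2) | c1 @ c2 = c. F (a @ i # c1) c2)"
    by (subst sum.reindex[OF inj(1)]) (simp add: o_def case_prod_unfold)
  moreover have "(\<Sum>(x, y) \<in> ?B. F x y) = (\<Sum>(a1, a2) | a1 @ a2 = a. F a1 (a2 @ i # c))"
    by (subst sum.reindex[OF inj(2)]) (simp add: o_def case_prod_unfold)
  ultimately show ?thesis
    unfolding eq
    by (subst sum.union_disjoint) (simp_all only: disj finite_imageI finite_splits2)
qed

lemma ncps_derivation_subst_der:
  fixes u :: "'n::finite \<Rightarrow> ('n, 'a::comm_ring_1) ncps"
  shows "ncps_derivation (ncps_subst_der u)"
  unfolding ncps_derivation_def
proof (intro conjI allI)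
  fix f g :: "('n, 'a) ncps" and c :: 'a
  show "ncps_subst_der u (f + g) = ncps_subst_der u f + ncps_subst_der u g"
    by (rule ncps_eqI)
       (simp add: ncps_subst_der_def case_prod_beta' distrib_right sum.distrib)
  show "ncps_subst_der u (ncps_smult c f) = ncps_smult c (ncps_subst_der u f)"
    by (rule ncps_eqI)
       (simp add: ncps_subst_der_def case_prod_beta' sum_distrib_left mult.assoc)
  show "ncps_subst_der u (f * g) = ncps_subst_der u f * g + f * ncps_subst_der u g"
  proof (rule ncps_eqI)
    fix w :: "'n list"
    let ?S3 = "{(a, b, c). a @ b @ c = w}" and ?S2 = "\<lambda>w::'n list. {(x, y). x @ y = w}"
    let ?S3' = "\<lambda>w::'n list. {(a, b, c). a @ b @ c = w}"
    have leibniz: "ncps_nth (f * g) (a @ i # c) * ncps_nth (u i) b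
        = (\<Sum>(c1, c2) \<in> ?S2 c. ncps_nth f (a @ i # c1) * ncps_nth (u i) b * ncps_nth g c2)
          + (\<Sum>(a1, a2) \<in> ?S2 a. ncps_nth f a1 * (ncps_nth g (a2 @ i # c) * ncps_nth (u i) b))"
      for a b c i
      unfolding ncps_nth_mult sum_splits_insert
      by (simp add: distrib_left sum_distrib_left case_prod_unfold mult_ac)
    have "ncps_nth (ncps_subst_der u (f * g)) w =
       (\<Sum>(a, b, c) \<in> ?S3. \<Sum>i\<in>UNIV. \<Sum>(c1, c2) \<in> ?S2 c.
           ncps_nth f (a @ i # c1) * ncps_nth (u i) b * ncps_nth g c2)
       + (\<Sum>(a, b, c) \<in> ?S3. \<Sum>i\<in>UNIV. \<Sum>(a1, a2) \<in> ?S2 a.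
           ncps_nth f a1 * (ncps_nth g (a2 @ i # c) * ncps_nth (u i) b))"
      by (simp add: ncps_subst_der_def leibniz sum.distrib case_prod_unfold)
    also have "(\<Sum>(a, b, c) \<in> ?S3. \<Sum>i\<in>UNIV. \<Sum>(c1, c2) \<in> ?S2 c.
           ncps_nth f (a @ i # c1) * ncps_nth (u i) b * ncps_nth g c2)
       = (\<Sum>q \<in> ?S3. \<Sum>r \<in> ?S2 (snd (snd q)). \<Sum>i\<in>UNIV.
           ncps_nth f (fst q @ i # fst r) * ncps_nth (u i) (fst (snd q)) * ncps_nth g (snd r))"
      by (simp add: case_prod_beta' sum.swap[of _ _ "UNIV :: 'n set"])
    also have "\<dots> = (\<Sum>(q, r) \<in> (SIGMA q:?S3. ?S2 (snd (snd q))). \<Sum>i\<in>UNIV.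
           ncps_nth f (fst q @ i # fst r) * ncps_nth (u i) (fst (snd q)) * ncps_nth g (snd r))"
      by (rule sum.Sigma) auto
    also have "\<dots> = (\<Sum>(q, r) \<in> (SIGMA q:?S2 w. ?S3' (fst q)). \<Sum>i\<in>UNIV.
           ncps_nth f (fst r @ i # snd (snd r)) * ncps_nth (u i) (fst (snd r)) * ncps_nth g (snd q))"
      by (rule sum.reindex_bij_witness
          [where i = "\<lambda>((x, y), (a, b, c)). ((a, b, c @ y), (c, y))"
             and j = "\<lambda>((a, b, c), (c1, c2)). ((a @ b @ c1, c2), (a, b, c1))"]) auto
    also have "\<dots> = (\<Sum>q \<in> ?S2 w. \<Sum>r \<in> ?S3' (fst q). \<Sum>i\<in>UNIV.
           ncps_nth f (fst r @ i # snd (snd r)) * ncps_nth (u i) (fst (snd r)) * ncps_nth g (snd q))"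
      by (rule sum.Sigma[symmetric]) auto
    also have "\<dots> = ncps_nth (ncps_subst_der u f * g) w"
      by (simp add: ncps_subst_der_def ncps_nth_mult sum_distrib_right case_prod_beta')
    also have "(\<Sum>(a, b, c) \<in> ?S3. \<Sum>i\<in>UNIV. \<Sum>(a1, a2) \<in> ?S2 a.
           ncps_nth f a1 * (ncps_nth g (a2 @ i # c) * ncps_nth (u i) b))
       = (\<Sum>q \<in> ?S3. \<Sum>r \<in> ?S2 (fst q). \<Sum>i\<in>UNIV.
           ncps_nth f (fst r) * (ncps_nth g (snd r @ i # snd (snd q)) * ncps_nth (u i) (fst (snd q))))"
      by (simp add: case_prod_beta' sum.swap[of _ _ "UNIV :: 'n set"])
    also have "\<dots> = (\<Sum>(q, r) \<in> (SIGMA q:?S3. ?S2 (fst q)). \<Sum>i\<in>UNIV.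
           ncps_nth f (fst r) * (ncps_nth g (snd r @ i # snd (snd q)) * ncps_nth (u i) (fst (snd q))))"
      by (rule sum.Sigma) auto
    also have "\<dots> = (\<Sum>(q, r) \<in> (SIGMA q:?S2 w. ?S3' (snd q)). \<Sum>i\<in>UNIV.
           ncps_nth f (fst q) * (ncps_nth g (fst r @ i # snd (snd r)) * ncps_nth (u i) (fst (snd r))))"
      by (rule sum.reindex_bij_witness
          [where i = "\<lambda>((x, y), (a, b, c)). ((x @ a, b, c), (x, a))"
             and j = "\<lambda>((a, b, c), (a1, a2)). ((a1, a2 @ b @ c), (a2, b, c))"]) auto
    also have "\<dots> = (\<Sum>q \<in> ?S2 w. \<Sum>r \<in> ?S3' (snd q). \<Sum>i\<in>UNIV.
           ncps_nth f (fst q) * (ncps_nth g (fst r @ i # snd (snd r)) * ncps_nth (u i) (fst (snd r))))"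
      by (rule sum.Sigma[symmetric]) auto
    also have "\<dots> = ncps_nth (f * ncps_subst_der u g) w"
      by (simp add: ncps_subst_der_def ncps_nth_mult sum_distrib_left case_prod_beta')
    finally show "ncps_nth (ncps_subst_der u (f * g)) w
        = ncps_nth (ncps_subst_der u f * g + f * ncps_subst_der u g) w"
      by simp
  qed
qed

lemma ncps_subst_der_var: "ncps_subst_der u (ncps_var i) = u i"
proof (rule ncps_eqI)
  fix w :: "'a list"
  have *: "(\<Sum>j\<in>UNIV. ncps_nth (ncps_var i) (a @ j # c) * ncps_nth (u j) b)
      = (if a = [] \<and> c = [] then ncps_nth (u i) b else 0)" for a b c
  proof -
    have "a @ j # c = [i] \<longleftrightarrow> a = [] \<and> c = [] \<and> j = i" for j
      by (auto simp: append_eq_Cons_conv)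
    then have "(\<Sum>j\<in>UNIV. ncps_nth (ncps_var i) (a @ j # c) * ncps_nth (u j) b)
        = (\<Sum>j\<in>UNIV. if j = i then (if a = [] \<and> c = [] then ncps_nth (u i) b else 0) else 0)"
      by (intro sum.cong) (auto simp: ncps_nth_var)
    then show ?thesis
      by simp
  qed
  have "ncps_nth (ncps_subst_der u (ncps_var i)) w
      = (\<Sum>(a, b, c) | a @ b @ c = w. if a = [] \<and> c = [] then ncps_nth (u i) b else 0)"
    by (simp add: ncps_subst_der_def *)
  also have "\<dots> = (\<Sum>(a, b, c) \<in> {([] :: 'a list, w, [] :: 'a list)}.
      if a = [] \<and> c = [] then ncps_nth (u i) b else 0)"
    by (rule sum.mono_neutral_cong_right) (auto split: if_splits)
  finally show "ncps_nth (ncps_subst_der u (ncps_var i)) w = ncps_nth (u i) w"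
    by simp
qed

lemma ncps_derivation_ex1:
  fixes u :: "'n::finite \<Rightarrow> ('n, 'a::comm_ring_1) ncps"
  shows "\<exists>!D. ncps_derivation D \<and> (\<forall>i. D (ncps_var i) = u i)"
proof (rule ex1I)
  show "ncps_derivation (ncps_subst_der u) \<and> (\<forall>i. ncps_subst_der u (ncps_var i) = u i)"
    by (simp add: ncps_derivation_subst_der ncps_subst_der_var)
qed (auto intro!: ncps_derivation_eqI ncps_derivation_subst_der simp: ncps_subst_der_var)

lemma ncps_vfield_eq: "ncps_vfield u = ncps_subst_der u"
  unfolding ncps_vfield_def
  by (rule the1_equality[OF ncps_derivation_ex1])
     (simp add: ncps_derivation_subst_der ncps_subst_der_var)

lemma ncps_vfield_derivation: "ncps_derivation (ncps_vfield u)"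
  by (simp add: ncps_vfield_eq ncps_derivation_subst_der)

lemma ncps_vfield_var: "ncps_vfield u (ncps_var i) = u i"
  by (simp add: ncps_vfield_eq ncps_subst_der_var)


section \<open>Series over \<open>k[[t]]\<close> and the Cauchy problem\<close>

definition ncps_dt :: "('n, 'a::comm_ring_1 fps) ncps \<Rightarrow> ('n, 'a fps) ncps" where
  "ncps_dt f = Abs_ncps (\<lambda>w. fps_deriv (ncps_nth f w))"

text \<open>
  The coefficient of \<open>t^j\<close>, a series over \<open>k\<close>; for \<open>j = 0\<close> this is the specialisation \<open>t = 0\<close>.
\<close>

definition ncps_tcoeff :: "nat \<Rightarrow> ('n, 'a::comm_ring_1 fps) ncps \<Rightarrow> ('n, 'a) ncps" where
  "ncps_tcoeff j f = Abs_ncps (\<lambda>w. fps_nth (ncps_nth f w) j)"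

text \<open>
  In \<open>W_t = (\<Sum>m\<ge>1. W_[m] t^(m-1))\<close> the vector \<open>W_[m]\<close> is the coefficient of \<open>t^(m-1)\<close>.
  Only \<open>m \<ge> 1\<close> is meaningful.
\<close>

definition ncps_bracket :: "('n \<Rightarrow> ('n, 'a::comm_ring_1 fps) ncps) \<Rightarrow> nat \<Rightarrow> 'n \<Rightarrow> ('n, 'a) ncps" where
  "ncps_bracket W m = (\<lambda>i. ncps_tcoeff (m - 1) (W i))"

definition cauchy_solution ::
    "('n::finite \<Rightarrow> ('n, 'a::comm_ring_1) ncps) \<Rightarrow> ('n \<Rightarrow> ('n, 'a fps) ncps) \<Rightarrow> bool" where
  "cauchy_solution H W \<longleftrightarrow>
     (\<forall>i. ncps_dt (W i) = ncps_vfield W (W i)) \<and>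
     (\<forall>i. ncps_tcoeff 0 (W i) = H i)"

end

theory Submission
  imports Defs
begin

text \<open>
  Write \<open>J\<close> for the set of \<open>j\<close> with \<open>j \<cdot> 1 = 0\<close> in \<open>k\<close>. The equation determines the coefficients
  of \<open>t^j\<close> with \<open>j \<notin> J\<close> from the earlier ones, since \<open>k\<close> is a domain; so a solution is determined by
  its coefficients at \<open>J\<close>. As \<open>k\<close> need not be a field, solutions cannot be obtained by dividing.
  Instead, if \<open>H\<close> satisfies \<open>\<partial>H/\<partial>t = 0\<close> and \<open>W\<close> satisfies the implicit equation
  \<open>W = H(z + tW)\<close>, then the derivation \<open>E = \<partial>/\<partial>t - [W \<partial>/\<partial>z]\<close> sends \<open>z + tW\<close> to \<open>t E(W)\<close>, and hence
  \<open>E(W) = E(H(z + tW))\<close> is divisible by every power of \<open>t\<close>, i.e. \<open>E(W) = 0\<close>. The coefficients of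
  such an \<open>H\<close> are arbitrary at \<open>J\<close> and can be adjusted one after the other so that \<open>W\<close> takes
  prescribed values there. Finally \<open>J = {0}\<close> in characteristic \<open>0\<close>, and \<open>J = p\<nat>\<close> in
  characteristic \<open>p\<close>.
\<close>

text \<open>Well-founded recursion along \<mu>. It builds both the substitution operator and the
  pair of series in \<open>cauchy_exists\<close>, one coefficient after the other.\<close>

lemma causal_fixpoint:
  fixes T :: "('i \<Rightarrow> 'b) \<Rightarrow> 'i \<Rightarrow> 'b" and \<mu> :: "'i \<Rightarrow> nat"
  assumes "\<And>x y i. (\<And>k. \<mu> k < \<mu> i \<Longrightarrow> x k = y k) \<Longrightarrow> T x i = T y i"
  obtains x where "\<And>i. x i = T x i"
proof -
  have "adm_wf (measure \<mu>) T"
    unfolding adm_wf_def using assms by (metis in_measure)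
  then have "wfrec (measure \<mu>) T = T (wfrec (measure \<mu>) T)"
    by (rule wfrec_fixpoint[OF wf_measure])
  then show thesis
    using that by metis
qed

section \<open>Coefficients\<close>

abbreviation coeff2 :: "('n, 'a::comm_ring_1 fps) ncps \<Rightarrow> 'n list \<Rightarrow> nat \<Rightarrow> 'a" where
  "coeff2 f w j \<equiv> fps_nth (ncps_nth f w) j"

lemma coeff2_eqI: "(\<And>w j. coeff2 f w j = coeff2 g w j) \<Longrightarrow> f = g"
  by (intro ncps_eqI fps_ext)

lemma ncps_nth_tcoeff [simp]: "ncps_nth (ncps_tcoeff j f) w = coeff2 f w j"
  by (simp add: ncps_tcoeff_def)

lemma coeff2_mult:
  "coeff2 (f * g) w j
    = (\<Sum>(u, v) | u @ v = w. \<Sum>a = 0..j. coeff2 f u a * coeff2 g v (j - a))"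
  by (simp add: ncps_nth_mult fps_sum_nth fps_mult_nth case_prod_unfold)

lemma coeff2_mult_cong:
  assumes "\<And>u v a. u @ v = w \<Longrightarrow> a \<le> j \<Longrightarrow> coeff2 f u a = coeff2 f' u a"
    and "\<And>u v a. u @ v = w \<Longrightarrow> a \<le> j \<Longrightarrow> coeff2 g v a = coeff2 g' v a"
  shows "coeff2 (f * g) w j = coeff2 (f' * g') w j"
  unfolding coeff2_mult
proof (intro sum.cong refl, clarify)
  fix u v assume "w = u @ v"
  then show "(\<Sum>a = 0..j. coeff2 f u a * coeff2 g v (j - a))
      = (\<Sum>a = 0..j. coeff2 f' u a * coeff2 g' v (j - a))"
    by (intro sum.cong refl arg_cong2[where f = "(*)"] assms) auto
qed

definition left_quot :: "'n \<Rightarrow> ('n, 'a) ncps \<Rightarrow> ('n, 'a) ncps" where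
  "left_quot i f = Abs_ncps (\<lambda>w. ncps_nth f (i # w))"

lemma ncps_nth_left_quot [simp]: "ncps_nth (left_quot i f) w = ncps_nth f (i # w)"
  by (simp add: left_quot_def)

lemma ncps_nth_sum_var_mult:
  fixes F :: "'n::finite \<Rightarrow> ('n, 'a::comm_ring_1) ncps"
  shows "ncps_nth (\<Sum>i\<in>UNIV. ncps_var i * F i) [] = 0"
    and "ncps_nth (\<Sum>i\<in>UNIV. ncps_var i * F i) (k # w) = ncps_nth (F k) w"
  by (simp_all add: ncps_nth_var ncps_nth_var_mult_Cons)

section \<open>Rules for \<partial>/\<partial>t and [W \<partial>/\<partial>z]\<close>

lemma ncps_dt_add: "ncps_dt (f + g) = ncps_dt f + ncps_dt g"
  by (rule ncps_eqI) (simp add: ncps_dt_def)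

lemma ncps_dt_zero [simp]: "ncps_dt 0 = 0"
  by (rule ncps_eqI) (simp add: ncps_dt_def)

lemma ncps_dt_sum: "ncps_dt (\<Sum>i\<in>A. F i) = (\<Sum>i\<in>A. ncps_dt (F i))"
  by (induction A rule: infinite_finite_induct) (simp_all add: ncps_dt_add)

lemma ncps_dt_mult: "ncps_dt (f * g) = ncps_dt f * g + f * ncps_dt g"
proof (rule ncps_eqI)
  fix w
  have "fps_deriv (\<Sum>q\<in>A. F q) = (\<Sum>q\<in>A. fps_deriv (F q :: 'b fps))"
    for A and F :: "'a list \<times> 'a list \<Rightarrow> 'b fps"
    by (induction A rule: infinite_finite_induct) simp_all
  then show "ncps_nth (ncps_dt (f * g)) w = ncps_nth (ncps_dt f * g + f * ncps_dt g) w"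
    by (simp add: ncps_dt_def ncps_nth_mult case_prod_unfold sum.distrib add.commute)
qed

lemma ncps_dt_smult: "ncps_dt (ncps_smult c f) = ncps_smult (fps_deriv c) f + ncps_smult c (ncps_dt f)"
  by (rule ncps_eqI) (simp add: ncps_dt_def add.commute)

lemma ncps_smult_1 [simp]: "ncps_smult 1 f = f"
  by (rule ncps_eqI) simp

lemma ncps_dt_var [simp]: "ncps_dt (ncps_var i) = 0"
  by (rule ncps_eqI) (simp add: ncps_dt_def ncps_nth_var)

lemma ncps_dt_one [simp]: "ncps_dt 1 = 0"
  by (rule ncps_eqI) (simp add: ncps_dt_def ncps_nth_one)

lemma
  fixes W :: "'n::finite \<Rightarrow> ('n, 'a::comm_ring_1) ncps"
  shows ncps_vfield_add: "ncps_vfield W (f + g) = ncps_vfield W f + ncps_vfield W g"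
    and ncps_vfield_smult: "ncps_vfield W (ncps_smult c f) = ncps_smult c (ncps_vfield W f)"
    and ncps_vfield_mult: "ncps_vfield W (f * g) = ncps_vfield W f * g + f * ncps_vfield W g"
  using ncps_vfield_derivation[of W] by (simp_all add: ncps_derivation_def)

lemma ncps_vfield_zero [simp]: "ncps_vfield W 0 = 0"
  using ncps_vfield_add[of W 0 0] by simp

lemma ncps_vfield_one [simp]: "ncps_vfield W 1 = 0"
  using ncps_vfield_mult[of W 1 1] by simp

lemma ncps_vfield_sum: "ncps_vfield W (\<Sum>i\<in>A. F i) = (\<Sum>i\<in>A. ncps_vfield W (F i))"
  by (induction A rule: infinite_finite_induct) (simp_all add: ncps_vfield_add)

section \<open>The substitution \<open>z \<mapsto> z + tW\<close>\<close>

text \<open>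
  The recursion characterises \<open>f(z + tW)\<close>: split off the constant term of \<open>f\<close> and the first letter
  of every other word.
\<close>

definition shift_step ::
    "('n::finite \<Rightarrow> ('n, 'a::comm_ring_1 fps) ncps) \<Rightarrow> (('n, 'a fps) ncps \<Rightarrow> ('n, 'a fps) ncps)
      \<Rightarrow> ('n, 'a fps) ncps \<Rightarrow> ('n, 'a fps) ncps" where
  "shift_step W S f = ncps_smult (ncps_nth f []) 1 + (\<Sum>i\<in>UNIV. ncps_var i * S (left_quot i f))
     + ncps_smult fps_X (\<Sum>i\<in>UNIV. W i * S (left_quot i f))"

text \<open>Choice picks one operator obeying the recursion; \<open>shift_unfold\<close> shows that
  there is one, and all later arguments go through the recursion.\<close>

definition shift ::
    "('n::finite \<Rightarrow> ('n, 'a::comm_ring_1 fps) ncps) \<Rightarrow> ('n, 'a fps) ncps \<Rightarrow> ('n, 'a fps) ncps" where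
  "shift W = (SOME S. \<forall>f. S f = shift_step W S f)"

lemma coeff2_shift_step_Nil:
  "coeff2 (shift_step W S f) [] j = coeff2 f [] j
     + (if j = 0 then 0 else \<Sum>i\<in>UNIV. coeff2 (W i * S (left_quot i f)) [] (j - 1))"
  by (simp only: shift_step_def ncps_nth_add ncps_nth_smult ncps_nth_sum_var_mult ncps_nth_one)
     (simp add: fps_sum_nth)

lemma coeff2_shift_step_Cons:
  "coeff2 (shift_step W S f) (k # w) j = coeff2 (S (left_quot k f)) w j
     + (if j = 0 then 0 else \<Sum>i\<in>UNIV. coeff2 (W i * S (left_quot i f)) (k # w) (j - 1))"
  by (simp only: shift_step_def ncps_nth_add ncps_nth_smult ncps_nth_sum_var_mult ncps_nth_one)
     (simp add: fps_sum_nth)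

text \<open>The recursion is well founded for word length plus t-degree: the branch at the first
  letter shortens the word, and the branch at tW lowers the t-degree without lengthening the
  word.\<close>

lemma shift_unfold: "shift W f = shift_step W (shift W) f"
proof -
  \<comment> \<open>An operator on series is stored as one scalar per series, word and t-degree, so
    that \<open>causal_fixpoint\<close> applies.\<close>
  define mk where "mk x f = Abs_ncps (\<lambda>w. Abs_fps (\<lambda>j. x (f, w, j)))"
    for x :: "('a, 'b fps) ncps \<times> 'a list \<times> nat \<Rightarrow> 'b" and f
  have mk: "coeff2 (mk x f) w j = x (f, w, j)" for x f w j
    by (simp add: mk_def)
  define T where "T x = (\<lambda>(f, w, j). coeff2 (shift_step W (mk x) f) w j)" for x
  obtain x where x: "\<And>q. x q = T x q"
  proof (rule causal_fixpoint[where T = T and \<mu> = "\<lambda>(f, w, j). length w + j"])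
    fix x y :: "('a, 'b fps) ncps \<times> 'a list \<times> nat \<Rightarrow> 'b" and q :: "('a, 'b fps) ncps \<times> 'a list \<times> nat"
    obtain f w j where q: "q = (f, w, j)"
      by (cases q)
    assume "\<And>k. (case k of (f, w, j) \<Rightarrow> length w + j) < (case q of (f, w, j) \<Rightarrow> length w + j)
      \<Longrightarrow> x k = y k"
    then have eq: "coeff2 (mk x g) v a = coeff2 (mk y g) v a" if "length v + a < length w + j" for g v a
      using that by (simp add: mk q)
    have tail: "coeff2 (W i * mk x g) w (j - 1) = coeff2 (W i * mk y g) w (j - 1)" if "j \<noteq> 0" for i g
      using that by (intro coeff2_mult_cong refl eq) auto
    show "T x q = T y q"
      unfolding q T_def prod.case
      by (cases w) (simp_all only: coeff2_shift_step_Nil coeff2_shift_step_Cons, use tail eq in auto)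
  qed blast
  have "mk x f = shift_step W (mk x) f" for f
  proof (rule coeff2_eqI)
    fix w j
    show "coeff2 (mk x f) w j = coeff2 (shift_step W (mk x) f) w j"
      using x[of "(f, w, j)"] by (simp add: mk T_def)
  qed
  then have "\<exists>S. \<forall>f. S f = shift_step W S f"
    by blast
  then have "\<forall>f. shift W f = shift_step W (shift W) f"
    unfolding shift_def by (rule someI_ex)
  then show ?thesis
    by blast
qed

lemmas coeff2_shift_Nil = coeff2_shift_step_Nil[of W "shift W" for W, folded shift_unfold]
lemmas coeff2_shift_Cons = coeff2_shift_step_Cons[of W "shift W" for W, folded shift_unfold]

text \<open>Replacing z by z + tW changes f only by terms with a factor t, so after subtracting f
  only coefficients below t^j enter. The induction on j encloses one on the word, with f arbitrary
  because its left quotients take its place.\<close>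

lemma shift_causal:
  assumes "\<And>i w a. a < j \<Longrightarrow> coeff2 (W i) w a = coeff2 (W' i) w a"
    and "\<And>w a. a < j \<Longrightarrow> coeff2 f w a = coeff2 f' w a"
  shows "coeff2 (shift W f - f) w j = coeff2 (shift W' f' - f') w j"
  using assms
proof (induction j arbitrary: f f' w rule: less_induct)
  case (less j)
  have shift_eq: "coeff2 (shift W g) v a = coeff2 (shift W' g') v a"
    if "a < j" and "\<And>v a. a < j \<Longrightarrow> coeff2 g v a = coeff2 g' v a" for g g' v a
    using less.IH[of a g g' v] less.prems(1) that by (simp add: that)
  have tail: "coeff2 (W i * shift W (left_quot i g)) v (j - 1)
      = coeff2 (W' i * shift W' (left_quot i g')) v (j - 1)"
    if "j \<noteq> 0" and "\<And>v a. a < j \<Longrightarrow> coeff2 g v a = coeff2 g' v a" for g g' v i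
    using that by (intro coeff2_mult_cong less.prems shift_eq) auto
  show ?case
    using less.prems(2)
  proof (induction w arbitrary: f f')
    case Nil
    then show ?case
      using tail[of f f'] by (simp add: coeff2_shift_Nil del: ncps_nth_mult_Nil)
  next
    case (Cons k w)
    have "coeff2 (shift W (left_quot k f)) w j - coeff2 f (k # w) j
        = coeff2 (shift W' (left_quot k f')) w j - coeff2 f' (k # w) j"
      using Cons.IH[of "left_quot k f" "left_quot k f'"] Cons.prems by simp
    then show ?case
      using tail[of f f'] Cons.prems by (cases "j = 0") (simp_all add: coeff2_shift_Cons algebra_simps)
  qed
qed

section \<open>The Cauchy problem\<close>

text \<open>In characteristic p the condition \<open>ncps_dt (H i) = 0\<close> still allows terms in
  t^(mp); this is the source of the freedom in the solutions.\<close>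

lemma shift_fixpoint_solves:
  fixes W H :: "'n::finite \<Rightarrow> ('n, 'a::comm_ring_1 fps) ncps"
  assumes W: "\<And>i. W i = shift W (H i)" and H: "\<And>i. ncps_dt (H i) = 0"
  shows "ncps_dt (W i) = ncps_vfield W (W i)"
proof -
  define E where "E f = ncps_dt f - ncps_vfield W f" for f
  have Emult: "E (f * g) = E f * g + f * E g" for f g
    by (simp add: E_def ncps_dt_mult ncps_vfield_mult algebra_simps)
  have Eadd: "E (f + g) = E f + E g" for f g
    by (simp add: E_def ncps_dt_add ncps_vfield_add)
  have Esum: "E (\<Sum>i\<in>A. F i) = (\<Sum>i\<in>A. E (F i))" for F :: "'n \<Rightarrow> _" and A
    by (simp add: E_def ncps_dt_sum ncps_vfield_sum sum_subtractf)
  have Esmult: "E (ncps_smult c f) = ncps_smult (fps_deriv c) f + ncps_smult c (E f)" for c f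
    by (rule ncps_eqI)
       (simp add: E_def ncps_dt_smult ncps_vfield_smult algebra_simps)
  have Evar: "E (ncps_var i) = - W i" for i
    by (simp add: E_def ncps_vfield_var)
  have Eone: "E 1 = 0"
    by (simp add: E_def)
  have zero: "ncps_smult 0 f = 0" "ncps_smult c 0 = 0" for c and f :: "('n, 'a fps) ncps"
    by (rule ncps_eqI, simp)+
  \<comment> \<open>\<open>E\<close> sends z_i to \<open>- W i\<close>, which cancels the
    \<open>W i\<close> that comes from differentiating t. What remains of \<open>E\<close> on z_i +
    t W_i is t E(W_i).\<close>
  have step: "E (shift W f) = (\<Sum>i\<in>UNIV. ncps_var i * E (shift W (left_quot i f)))
      + ncps_smult fps_X (\<Sum>i\<in>UNIV. E (W i) * shift W (left_quot i f) + W i * E (shift W (left_quot i f)))"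
    if "ncps_dt f = 0" for f
  proof -
    have "fps_deriv (ncps_nth f []) = ncps_nth (ncps_dt f) []"
      by (simp add: ncps_dt_def)
    then have "fps_deriv (ncps_nth f []) = 0"
      by (simp add: that)
    then show ?thesis
      by (subst shift_unfold)
         (simp add: shift_step_def Eadd Esum Esmult Emult Evar Eone zero sum.distrib sum_subtractf)
  qed
  have const: "ncps_dt (left_quot i f) = 0" if "ncps_dt f = 0" for i and f :: "('n, 'a fps) ncps"
  proof (rule ncps_eqI)
    fix w
    show "ncps_nth (ncps_dt (left_quot i f)) w = ncps_nth 0 w"
      using arg_cong[OF that, of "\<lambda>g. ncps_nth g (i # w)"] by (simp add: ncps_dt_def)
  qed
  have "coeff2 (E (shift W f)) w j = 0" if "ncps_dt f = 0" for f w j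
    using that
  proof (induction j arbitrary: f w rule: less_induct)
    case (less j)
    have tail: "coeff2 (ncps_smult fps_X
        (\<Sum>i\<in>UNIV. E (W i) * shift W (left_quot i g) + W i * E (shift W (left_quot i g)))) v j = 0"
      if g: "ncps_dt g = 0" for g v
    proof (cases "j = 0")
      case False
      \<comment> \<open>Since W_i is the substitution applied to H_i, the induction hypothesis for
        \<open>H i\<close> controls E(W_i); the factor t supplies the drop in degree.\<close>
      then have "coeff2 (E (W i)) u a = 0" "coeff2 (E (shift W (left_quot i g))) u a = 0"
        if "a \<le> j - 1" for i u a
        using less.IH[of a "H i" u, OF _ H] less.IH[of a "left_quot i g" u, OF _ const[OF g]] that
        by (simp_all flip: W)
      then have "coeff2 (E (W i) * shift W (left_quot i g)) v (j - 1) = 0"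
        "coeff2 (W i * E (shift W (left_quot i g))) v (j - 1) = 0" for i
        by (auto simp: coeff2_mult intro!: sum.neutral)
      then show ?thesis
        by (simp add: fps_sum_nth)
    qed simp
    show ?case
      using less.prems
    proof (induction w arbitrary: f)
      case Nil
      show ?case
        unfolding step[OF Nil] ncps_nth_add fps_add_nth tail[OF Nil] ncps_nth_sum_var_mult
        by simp
    next
      case (Cons k w)
      show ?case
        unfolding step[OF Cons.prems] ncps_nth_add fps_add_nth tail[OF Cons.prems]
          ncps_nth_sum_var_mult
        using Cons.IH[OF const[OF Cons.prems]] by simp
    qed
  qed
  then have "E (W i) = 0"
    using H[of i] W[of i] by (intro coeff2_eqI) simp
  then show ?thesis
    by (simp add: E_def)
qed

lemma cauchy_exists:
  fixes V :: "nat \<Rightarrow> 'n::finite \<Rightarrow> ('n, 'a::comm_ring_1) ncps"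
  obtains W where "\<And>i. ncps_dt (W i) = ncps_vfield W (W i)"
    and "\<And>j i. of_nat j = (0::'a) \<Longrightarrow> ncps_tcoeff j (W i) = V j i"
proof -
  define mk where "mk x i = Abs_ncps (\<lambda>w. Abs_fps (\<lambda>j. ncps_nth (x j i) w))"
    for x :: "nat \<Rightarrow> 'n \<Rightarrow> ('n, 'a) ncps" and i
  have mk: "coeff2 (mk x i) w j = ncps_nth (x j i) w" for x i w j
    by (simp add: mk_def)
  define Q where "Q x j i = ncps_tcoeff j
      (shift (mk (\<lambda>j i. fst (x j i))) (mk (\<lambda>j i. snd (x j i)) i) - mk (\<lambda>j i. snd (x j i)) i)"
    for x :: "nat \<Rightarrow> 'n \<Rightarrow> ('n, 'a) ncps \<times> ('n, 'a) ncps" and j i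
  \<comment> \<open>The components are the coefficients of t^j in W and in H. In both cases they
    differ by \<open>Q\<close>, which amounts to W = H(z + tW). If j = 0 in k, the coefficient of H
    is chosen so that W hits \<open>V\<close>; otherwise it is 0, which keeps
    \<partial>H/\<partial>t = 0. By \<open>shift_causal\<close>, \<open>Q\<close> depends only on
    lower coefficients.\<close>
  define T where
    "T x j = (\<lambda>i. if of_nat j = (0::'a) then (V j i, V j i - Q x j i) else (Q x j i, 0))" for x j
  obtain x where x: "\<And>j. x j = T x j"
  proof (rule causal_fixpoint[where T = T and \<mu> = "\<lambda>j. j"])
    fix x y :: "nat \<Rightarrow> 'n \<Rightarrow> ('n, 'a) ncps \<times> ('n, 'a) ncps" and j
    assume "\<And>k. k < j \<Longrightarrow> x k = y k"
    then have "Q x j i = Q y j i" for i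
      unfolding Q_def by (intro ncps_eqI, unfold ncps_nth_tcoeff, intro shift_causal) (simp_all add: mk)
    then show "T x j = T y j"
      by (simp add: T_def fun_eq_iff)
  qed blast
  define W where "W = mk (\<lambda>j i. fst (x j i))"
  define H where "H = mk (\<lambda>j i. snd (x j i))"
  have Q: "ncps_nth (Q x j i) w = coeff2 (shift W (H i)) w j - coeff2 (H i) w j" for i w j
    by (simp add: Q_def W_def H_def)
  have W: "coeff2 (W i) w j = (if of_nat j = (0::'a) then ncps_nth (V j i) w else ncps_nth (Q x j i) w)"
    for i w j
    using x[of j] by (simp add: W_def mk T_def)
  have H: "coeff2 (H i) w j = (if of_nat j = (0::'a) then ncps_nth (V j i) w - ncps_nth (Q x j i) w else 0)"
    for i w j
    using x[of j] by (simp add: H_def mk T_def)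
  show thesis
  proof
    show "ncps_dt (W i) = ncps_vfield W (W i)" for i
    proof (rule shift_fixpoint_solves)
      show "W i = shift W (H i)" for i
      proof (rule coeff2_eqI)
        fix w j
        show "coeff2 (W i) w j = coeff2 (shift W (H i)) w j"
          using Q[of j i w] W[of i w j] H[of i w j] by (auto split: if_splits)
      qed
      show "ncps_dt (H i) = 0" for i
      proof (rule coeff2_eqI)
        fix w j
        \<comment> \<open>This is j + 1 times the coefficient of t^(j+1) in H, and one of the two
          factors is 0.\<close>
        show "coeff2 (ncps_dt (H i)) w j = coeff2 0 w j"
          using H[of i w "Suc j"] by (auto simp: ncps_dt_def simp del: of_nat_Suc split: if_splits)
      qed
    qed
    show "ncps_tcoeff j (W i) = V j i" if "of_nat j = (0::'a)" for j i
      by (rule ncps_eqI) (simp add: W that)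
  qed
qed

section \<open>Uniqueness of the solution\<close>

lemma coeff2_vfield:
  "coeff2 (ncps_vfield u f) w j = (\<Sum>(a, b, c) | a @ b @ c = w. \<Sum>i\<in>UNIV. \<Sum>l = 0..j.
     coeff2 f (a @ i # c) l * coeff2 (u i) b (j - l))"
  by (simp add: ncps_vfield_eq ncps_subst_der_def fps_sum_nth fps_mult_nth case_prod_unfold)

lemma cauchy_unique:
  fixes W W' :: "'n::finite \<Rightarrow> ('n, 'a::idom fps) ncps"
  assumes "\<And>i. ncps_dt (W i) = ncps_vfield W (W i)" "\<And>i. ncps_dt (W' i) = ncps_vfield W' (W' i)"
    and eq: "\<And>j i. of_nat j = (0::'a) \<Longrightarrow> ncps_tcoeff j (W i) = ncps_tcoeff j (W' i)"
  shows "W = W'"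
proof -
  have rec: "of_nat (Suc j) * coeff2 (U i) w (Suc j) = coeff2 (ncps_vfield U (U i)) w j"
    if "\<And>i. ncps_dt (U i) = ncps_vfield U (U i)" for U :: "'n \<Rightarrow> ('n, 'a fps) ncps" and i w j
    by (simp flip: that) (simp add: ncps_dt_def)
  have "coeff2 (W i) w j = coeff2 (W' i) w j" for i w j
  proof (induction j arbitrary: i w rule: less_induct)
    case (less j)
    show ?case
    proof (cases "of_nat j = (0::'a)")
      case True
      then show ?thesis
        using arg_cong[OF eq, of j "\<lambda>f. ncps_nth f w"] by simp
    next
      case False
      \<comment> \<open>The index 0 falls under the other case, so here the coefficient of t^j is
        governed by the equation at t^(j-1), whose right side involves only lower
        coefficients.\<close>
      then obtain l where l: "j = Suc l"
        by (cases j) auto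
      have "coeff2 (ncps_vfield W (W i)) w l = coeff2 (ncps_vfield W' (W' i)) w l"
        unfolding coeff2_vfield case_prod_unfold
        by (intro sum.cong refl arg_cong2[where f = "(*)"] less.IH) (auto simp: l)
      then have "of_nat j * coeff2 (W i) w j = of_nat j * coeff2 (W' i) w j"
        unfolding l using rec[of W l i w] rec[of W' l i w] assms by simp
      then show ?thesis
        using False by simp
    qed
  qed
  then show ?thesis
    by (intro ext coeff2_eqI)
qed

section \<open>Unique solvability in each characteristic\<close>

lemma cauchy_ex1:
  fixes V :: "nat \<Rightarrow> 'n::finite \<Rightarrow> ('n, 'a::idom) ncps"
  shows "\<exists>!W. (\<forall>i. ncps_dt (W i) = ncps_vfield W (W i)) \<and>
           (\<forall>j i. of_nat j = (0::'a) \<longrightarrow> ncps_tcoeff j (W i) = V j i)"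
proof -
  obtain W where "\<And>i. ncps_dt (W i) = ncps_vfield W (W i)"
    and "\<And>j i. of_nat j = (0::'a) \<Longrightarrow> ncps_tcoeff j (W i) = V j i"
    using cauchy_exists[of V] by blast
  then show ?thesis
    by (intro ex1I[of _ W]) (auto intro: cauchy_unique)
qed

lemma cauchy_ex1_char_p:
  fixes H :: "'n::finite \<Rightarrow> ('n, 'k::idom) ncps" and V :: "nat \<Rightarrow> 'n \<Rightarrow> ('n, 'k) ncps"
  assumes p: "CHAR('k) = p" "p > 0"
  shows "\<exists>!W. cauchy_solution H W \<and> (\<forall>m\<ge>1. ncps_bracket W (m * p + 1) = V m)"
proof -
  \<comment> \<open>Here j = 0 in k means that p divides j. The index 0 carries the initial value
    and j = mp carries \<open>V m\<close>, as \<open>ncps_bracket\<close> at mp + 1 is the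
    coefficient of t^(mp).\<close>
  have "cauchy_solution H W \<and> (\<forall>m\<ge>1. ncps_bracket W (m * p + 1) = V m) \<longleftrightarrow>
      (\<forall>i. ncps_dt (W i) = ncps_vfield W (W i)) \<and>
      (\<forall>j i. of_nat j = (0::'k) \<longrightarrow> ncps_tcoeff j (W i) = (if j = 0 then H else V (j div p)) i)"
    (is "?L W \<longleftrightarrow> ?R W") for W
  proof
    assume L: "?L W"
    show "?R W"
    proof (intro conjI allI impI)
      fix j i assume "of_nat j = (0::'k)"
      then obtain m where m: "j = m * p"
        using p by (auto simp: of_nat_eq_0_iff_char_dvd dvd_def mult.commute)
      show "ncps_tcoeff j (W i) = (if j = 0 then H else V (j div p)) i"
      proof (cases "m = 0")
        case False
        then have "ncps_bracket W (m * p + 1) = V m"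
          using L by simp
        from fun_cong[OF this, of i] show ?thesis
          using False p by (simp add: m ncps_bracket_def)
      qed (use L m in \<open>simp add: cauchy_solution_def\<close>)
    qed (use L in \<open>simp add: cauchy_solution_def\<close>)
  next
    assume R: "?R W"
    have "of_nat (m * p) = (0::'k)" for m
      using p(1) by (simp only: of_nat_eq_0_iff_char_dvd dvd_triv_right)
    then have *: "ncps_tcoeff (m * p) (W i) = (if m = 0 then H else V m) i" for m i
      using conjunct2[OF R, rule_format, of "m * p" i] p(2) by simp
    have "ncps_bracket W (m * p + 1) = V m" if "m \<ge> 1" for m
      using *[of m] that by (auto simp: ncps_bracket_def)
    moreover have "cauchy_solution H W"
      using conjunct1[OF R] *[of 0] by (simp add: cauchy_solution_def)
    ultimately show "?L W"
      by blast
  qed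
  then show ?thesis
    using cauchy_ex1[of "\<lambda>j. if j = 0 then H else V (j div p)"] by simp
qed

theorem corollary5p2:
  fixes H :: "'n::finite \<Rightarrow> ('n, 'k::idom) ncps"
  assumes "ncps_vec_order H \<ge> 2"
  shows "(CHAR('k) = 0 \<longrightarrow> (\<exists>!W. cauchy_solution H W)) \<and>
         (\<forall>p. CHAR('k) = p \<and> p > 0 \<longrightarrow>
            infinite {W. cauchy_solution H W} \<and>
            (\<forall>V :: nat \<Rightarrow> 'n \<Rightarrow> ('n, 'k) ncps.
               \<exists>!W. cauchy_solution H W \<and> (\<forall>m\<ge>1. ncps_bracket W (m * p + 1) = V m)))"
proof (intro conjI impI allI; (elim conjE)?)
  assume "CHAR('k) = 0"
  then have "(of_nat j = (0::'k)) = (j = 0)" for j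
    by (simp add: of_nat_eq_0_iff_char_dvd)
  then show "\<exists>!W. cauchy_solution H W"
    using cauchy_ex1[of "\<lambda>_. H"] by (simp add: cauchy_solution_def)
next
  fix p V assume "CHAR('k) = p" "p > 0"
  then show "\<exists>!W. cauchy_solution H W \<and> (\<forall>m\<ge>1. ncps_bracket W (m * p + 1) = V m)"
    by (rule cauchy_ex1_char_p)
next
  fix p assume p: "CHAR('k) = p" "p > 0"
  \<comment> \<open>The prescription \<open>V l\<close> is 1 exactly at m = l, so different l \<ge>
    1 force different solutions.\<close>
  define V :: "nat \<Rightarrow> nat \<Rightarrow> 'n \<Rightarrow> ('n, 'k) ncps" where "V l m i = (if m = l then 1 else 0)" for l m i
  have "\<forall>l. \<exists>W. cauchy_solution H W \<and> (\<forall>m\<ge>1. ncps_bracket W (m * p + 1) = V l m)"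
    using cauchy_ex1_char_p[OF p] by blast
  then obtain W where W: "\<And>l. cauchy_solution H (W l)"
    "\<And>l m. m \<ge> 1 \<Longrightarrow> ncps_bracket (W l) (m * p + 1) = V l m"
    by metis
  have "inj_on W {1..}"
  proof (rule inj_onI)
    fix l l' :: nat assume "l \<in> {1..}" "l' \<in> {1..}" "W l = W l'"
    then have "V l l = V l' l"
      using W(2) by (metis atLeast_iff)
    then show "l = l'"
      by (auto simp: V_def fun_eq_iff split: if_splits)
  qed
  then have "infinite (W ` {1..})"
    by (simp add: finite_image_iff infinite_Ici)
  then show "infinite {W. cauchy_solution H W}"
    using W(1) by (auto elim: contrapos_nn intro: finite_subset[rotated])
qed

end
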